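(* Let $a$ be a nonzero even integer, let $k,m$ be positive integers with $m\ge 4$, and let $b$ be a nonnegative integer. If $b$ is even, then $$E_{2^mk+b}^{(a)}-E_b^{(a)}\equiv 2^{m}k\{9a^3b^2-(2a^3-128a)b+86a^3-257a+2^{m}ka^3(b-1)\}\pmod{2^{m+10}}.$$ If $b$ is odd, then $$E_{2^mk+b}^{(a)}-E_b^{(a)}\equiv 2^{m}k\{(a^3-2a^5)b^2+(30a^3+128a)b-2a^5+86a^3+127a+2^{m}ka^3(b-1)\}\pmod{2^{m+10}}.$$
   Context: For a nonzero integer $a$, the sequence $\{E_n^{(a)}\}_{n\ge 0}$ is the sequence of integers defined recursively by $$\sum_{j=0}^{\lfloor n/2\rfloor}\binom{n}{2j}a^{2j}E_{n-2j}^{(a)}=(1-a)^n\quad(n=0,1,2,\ldots).$$ *)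

theory Defs
  imports "HOL-Number_Theory.Cong"
begin

text \<open>The summand \<open>j = 0\<close> of the defining relation is \<open>gen_euler a n\<close> itself; the equation below is
  that relation solved for this summand. The relation in its original form is
  \<open>gen_euler_recurrence\<close>, and \<open>gen_euler_unique\<close> shows that it determines the sequence.\<close>

function gen_euler :: "int \<Rightarrow> nat \<Rightarrow> int" where
  "gen_euler a n = (1 - a) ^ n -
     (\<Sum>j = 1..n div 2. int (n choose (2 * j)) * a ^ (2 * j) * gen_euler a (n - 2 * j))"
  by auto
termination
  by (relation "measure snd") auto

declare gen_euler.simps [simp del]

lemma sum_split_zero:
  fixes f :: "nat \<Rightarrow> int"
  shows "(\<Sum>j = 0..N. f j) = f 0 + (\<Sum>j = 1..N. f j)"
  by (simp add: sum.atLeast_Suc_atMost)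

lemma gen_euler_recurrence:
  "(\<Sum>j = 0..n div 2. int (n choose (2 * j)) * a ^ (2 * j) * gen_euler a (n - 2 * j)) = (1 - a) ^ n"
  by (subst sum_split_zero) (simp add: gen_euler.simps [of a n])

lemma gen_euler_unique:
  assumes "\<And>n. (\<Sum>j = 0..n div 2. int (n choose (2 * j)) * a ^ (2 * j) * E (n - 2 * j)) = (1 - a) ^ n"
  shows "E n = gen_euler a n"
proof (induction n rule: less_induct)
  case (less n)
  have "(\<Sum>j = 1..n div 2. int (n choose (2 * j)) * a ^ (2 * j) * E (n - 2 * j)) =
        (\<Sum>j = 1..n div 2. int (n choose (2 * j)) * a ^ (2 * j) * gen_euler a (n - 2 * j))"
    by (rule sum.cong) (auto intro!: less)
  with assms [of n] show ?case
    by (subst (asm) sum_split_zero) (simp add: gen_euler.simps [of a n])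
qed

end

theory Submission
  imports Defs
begin

text \<open>The generating function of the sequence is \<open>e\<^sup>t (1 - tanh (a t))\<close>, so
  \<open>gen_euler a n = (\<Sum>i\<le>n. (n choose i) * a ^ i * S\<^sub>i)\<close> with the integers \<open>S\<^sub>i\<close> given by
  \<open>1 - tanh x = (\<Sum>i. S\<^sub>i x\<^sup>i / i!)\<close>. If \<open>2\<^sup>m\<close> divides \<open>n\<close>, then by Vandermonde the difference
  \<open>(n + b choose i) - (b choose i)\<close> is divisible by \<open>2\<^sup>m\<close> up to a factor of at most \<open>i\<close>. As \<open>a\<close> is
  even and \<open>S\<^sub>9\<close>, \<open>S\<^sub>1\<^sub>1\<close> are divisible by \<open>2\<^sup>8\<close>, only the terms \<open>i = 1, 3, 5, 7\<close> of
  \<open>gen_euler a (n + b) - gen_euler a b\<close> survive modulo \<open>2\<^sup>m\<^sup>+\<^sup>1\<^sup>0\<close>. These are polynomials divisible by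
  \<open>n\<close>, and it remains to compare the cofactors modulo \<open>2\<^sup>1\<^sup>0\<close>.\<close>

section \<open>Coefficients of \<open>1 - tanh\<close> and expansion of the sequence\<close>

text \<open>The exponential generating function is \<open>1 - tanh x = 2 / (exp (2 x) + 1)\<close>.\<close>

function logistic_coeff :: "nat \<Rightarrow> int" where
  "logistic_coeff n = (- 1) ^ n -
     (\<Sum>j = 1..n div 2. int (n choose (2 * j)) * logistic_coeff (n - 2 * j))"
  by auto
termination
  by (relation "measure id") auto

declare logistic_coeff.simps [simp del]

lemma logistic_coeff_recurrence:
  "(\<Sum>j = 0..n div 2. int (n choose (2 * j)) * logistic_coeff (n - 2 * j)) = (- 1) ^ n"
  by (subst sum_split_zero) (simp add: logistic_coeff.simps [of n])

lemma binomial_numeral: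
  "(n choose numeral l) = n * ((n - 1) choose pred_numeral l) div numeral l"
  using times_binomial_minus1_eq [of "numeral l" n]
  by (metis nonzero_mult_div_cancel_left numeral_eq_Suc diff_Suc_1 zero_less_numeral zero_neq_numeral)

lemma logistic_coeff_values:
  "logistic_coeff 0 = 1" "logistic_coeff (Suc 0) = - 1" "logistic_coeff 2 = 0" "logistic_coeff 3 = 2" "logistic_coeff 4 = 0"
  "logistic_coeff 5 = - 16" "logistic_coeff 6 = 0" "logistic_coeff 7 = 272" "logistic_coeff 8 = 0"
  "logistic_coeff 9 = - 7936" "logistic_coeff 10 = 0" "logistic_coeff 11 = 353792" "logistic_coeff 12 = 0"
proof -
  note * = sum.atLeast_Suc_atMost binomial_numeral
  show [simp]: "logistic_coeff 0 = 1"
    by (subst logistic_coeff.simps) simp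
  show [simp]: "logistic_coeff (Suc 0) = - 1"
    by (subst logistic_coeff.simps) simp
  show [simp]: "logistic_coeff 2 = 0"
    by (simp add: logistic_coeff.simps [of 2] *)
  show [simp]: "logistic_coeff 3 = 2"
    by (simp add: logistic_coeff.simps [of 3] *)
  show [simp]: "logistic_coeff 4 = 0"
    by (simp add: logistic_coeff.simps [of 4] *)
  show [simp]: "logistic_coeff 5 = - 16"
    by (simp add: logistic_coeff.simps [of 5] *)
  show [simp]: "logistic_coeff 6 = 0"
    by (simp add: logistic_coeff.simps [of 6] *)
  show [simp]: "logistic_coeff 7 = 272"
    by (simp add: logistic_coeff.simps [of 7] *)
  show [simp]: "logistic_coeff 8 = 0"
    by (simp add: logistic_coeff.simps [of 8] *)
  show [simp]: "logistic_coeff 9 = - 7936"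
    by (simp add: logistic_coeff.simps [of 9] *)
  show [simp]: "logistic_coeff 10 = 0"
    by (simp add: logistic_coeff.simps [of 10] *)
  show [simp]: "logistic_coeff 11 = 353792"
    by (simp add: logistic_coeff.simps [of 11] *)
  show [simp]: "logistic_coeff 12 = 0"
    by (simp add: logistic_coeff.simps [of 12] *)
qed

text \<open>By \<open>gen_euler_unique\<close> it suffices that the sum solves the defining
  relation. Collecting terms with \<open>s = 2 * j + i\<close> leaves the recurrence of
  \<open>logistic_coeff\<close> inside and the binomial theorem for \<open>(1 - a) ^ n\<close>
  outside.\<close>

lemma gen_euler_eq_sum:
  "gen_euler a n = (\<Sum>i\<le>n. int (n choose i) * a ^ i * logistic_coeff i)"
proof (rule gen_euler_unique [symmetric])
  fix n
  have choose: "int (n choose (2 * j)) * int ((n - 2 * j) choose i) =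
      int (n choose (2 * j + i)) * int ((2 * j + i) choose (2 * j))" if "2 * j + i \<le> n" for i j
    using choose_mult [of "2 * j" "2 * j + i" n] that by (simp flip: of_nat_mult)
  have "(\<Sum>j = 0..n div 2. int (n choose (2 * j)) * a ^ (2 * j) *
          (\<Sum>i\<le>n - 2 * j. int ((n - 2 * j) choose i) * a ^ i * logistic_coeff i)) =
      (\<Sum>(j, i)\<in>(SIGMA j:{0..n div 2}. {..n - 2 * j}).
          int (n choose (2 * j)) * int ((n - 2 * j) choose i) * a ^ (2 * j + i) * logistic_coeff i)"
    by (simp add: sum.Sigma sum_distrib_left power_add mult_ac)
  also have "\<dots> = (\<Sum>(s, j)\<in>(SIGMA s:{..n}. {0..s div 2}).
          int (n choose s) * int (s choose (2 * j)) * a ^ s * logistic_coeff (s - 2 * j))"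
    by (rule sum.reindex_bij_witness [of _ "\<lambda>(s, j). (j, s - 2 * j)" "\<lambda>(j, i). (2 * j + i, j)"])
      (auto simp: choose)
  also have "\<dots> = (\<Sum>s\<le>n. int (n choose s) * a ^ s *
          (\<Sum>j = 0..s div 2. int (s choose (2 * j)) * logistic_coeff (s - 2 * j)))"
    by (simp add: sum.Sigma sum_distrib_left mult_ac)
  also have "\<dots> = (\<Sum>s\<le>n. int (n choose s) * (- a) ^ s)"
    unfolding logistic_coeff_recurrence power_minus [of a] by (simp add: mult.left_commute mult.commute)
  also have "\<dots> = (1 - a) ^ n"
    using binomial_ring [of "- a" 1 n] by simp
  finally show "(\<Sum>j = 0..n div 2. int (n choose (2 * j)) * a ^ (2 * j) *
          (\<Sum>i\<le>n - 2 * j. int ((n - 2 * j) choose i) * a ^ i * logistic_coeff i)) = (1 - a) ^ n" .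
qed

section \<open>Binomial coefficients: powers of two and falling factorials\<close>

text \<open>In \<open>i * (n choose i) = n * ((n - 1) choose (i - 1))\<close>, cancelling
  \<open>i\<close> costs at most its 2-part, which is at most \<open>2 ^ l\<close> because
  \<open>i < 2 ^ Suc l\<close>.\<close>

lemma two_power_dvd_binomial:
  assumes "2 ^ m dvd n" and "0 < i" and "i < 2 ^ Suc l"
  shows "2 ^ m dvd 2 ^ l * (n choose i)"
proof -
  define v where "v = multiplicity 2 i"
  obtain q where q: "i = 2 ^ v * q" "odd q"
    using multiplicity_decompose' [of i 2] \<open>0 < i\<close> by (auto simp: v_def)
  have "2 ^ v \<le> i"
    using \<open>0 < i\<close> by (simp add: v_def dvd_imp_le multiplicity_dvd)
  with assms(3) have "(2::nat) ^ v < 2 ^ Suc l"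
    by linarith
  then have "v \<le> l"
    using power_strict_increasing_iff [of "2::nat" v "Suc l"] by simp
  then have "2 ^ l = 2 ^ (l - v) * (2::nat) ^ v"
    by (simp flip: power_add)
  then have "q * (2 ^ l * (n choose i)) = 2 ^ (l - v) * (i * (n choose i))"
    using q(1) by simp
  also have "i * (n choose i) = n * ((n - 1) choose (i - 1))"
    using \<open>0 < i\<close> times_binomial_minus1_eq by simp
  finally have "2 ^ m dvd q * (2 ^ l * (n choose i))"
    using assms(1) by simp
  then show ?thesis
    using q(2) by (simp add: coprime_dvd_mult_right_iff)
qed

text \<open>In Vandermonde's identity the summand \<open>i = 0\<close> is \<open>b choose j\<close>;
  every other one contains \<open>n choose i\<close> with \<open>i\<close> positive and at most
  \<open>j\<close>.\<close>

lemma two_power_dvd_binomial_diff: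
  assumes "2 ^ m dvd n" and "j < 2 ^ Suc l"
  shows "2 ^ m dvd 2 ^ l * (int ((n + b) choose j) - int (b choose j))"
proof -
  have "int ((n + b) choose j) - int (b choose j) = (\<Sum>i = 1..j. int (n choose i) * int (b choose (j - i)))"
    by (simp add: sum.atLeast_Suc_atMost atMost_atLeast0 flip: vandermonde)
  moreover have "2 ^ m dvd 2 ^ l * int (n choose i)" if "i \<in> {1..j}" for i
  proof -
    have "2 ^ m dvd 2 ^ l * (n choose i)"
      using that assms by (intro two_power_dvd_binomial) auto
    then have "int (2 ^ m) dvd int (2 ^ l * (n choose i))"
      by (simp only: of_nat_dvd_iff)
    then show ?thesis
      by simp
  qed
  ultimately show ?thesis
    by (auto simp: sum_distrib_left mult.assoc [symmetric] intro!: dvd_sum)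
qed

lemma fact_mult_binomial:
  "fact j * int (x choose j) = (\<Prod>i<j. int x - int i)"
proof (induction j)
  case (Suc j)
  have "int (Suc j) * int (x choose Suc j) = (int x - int j) * int (x choose j)"
  proof (cases "j \<le> x")
    case True
    have "Suc j * (x choose Suc j) = (x - j) * (x choose j)"
      by (simp only: binomial_absorption binomial_absorb_comp)
    then show ?thesis
      using True by (metis of_nat_diff of_nat_mult)
  qed (simp add: binomial_eq_0)
  then have "fact (Suc j) * int (x choose Suc j) = fact j * ((int x - int j) * int (x choose j))"
    by (simp only: fact_Suc of_nat_mult mult_ac of_nat_fact)
  with Suc show ?case
    by (simp add: mult_ac)
qed simp

section \<open>Reduction to the terms of index 1, 3, 5, 7\<close>

lemma gen_euler_diff_cong_binomial:
  assumes "even a" and "2 ^ m dvd n"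
  shows "[gen_euler a (n + b) - gen_euler a b =
      - (a * int n) + 2 * a ^ 3 * (int ((n + b) choose 3) - int (b choose 3))
      - 16 * a ^ 5 * (int ((n + b) choose 5) - int (b choose 5))
      + 272 * a ^ 7 * (int ((n + b) choose 7) - int (b choose 7))] (mod (2 ^ (m + 10)))"
proof -
  \<comment> \<open>Beyond \<open>n + b\<close> the binomials vanish, so both values become sums
    over one range, long enough to be split at 9.\<close>
  define N where "N = n + b + 9"
  define t where "t i = (int ((n + b) choose i) - int (b choose i)) * a ^ i * logistic_coeff i" for i
  have extend: "gen_euler a x = (\<Sum>i<N. int (x choose i) * a ^ i * logistic_coeff i)" if "x \<le> n + b" for x
    unfolding gen_euler_eq_sum using that by (intro sum.mono_neutral_left) (auto simp: N_def)
  have "gen_euler a (n + b) - gen_euler a b = (\<Sum>i<N. t i)"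
    by (simp add: extend t_def sum_subtractf left_diff_distrib)
  also have "\<dots> = (\<Sum>i<9. t i) + (\<Sum>i=9..<N. t i)"
    by (simp add: N_def lessThan_atLeast0 sum.atLeastLessThan_concat)
  finally have split: "gen_euler a (n + b) - gen_euler a b = (\<Sum>i<9. t i) + (\<Sum>i=9..<N. t i)" .

  \<comment> \<open>Exponents of two: \<open>m\<close> from the binomial difference at a cost of
    \<open>l\<close>, \<open>j\<close> from \<open>a ^ j\<close>, and \<open>e\<close> from the
    coefficient.\<close>
  have t_dvd: "2 ^ (m + 10) dvd t j"
    if "j < 2 ^ Suc l" and "2 ^ e dvd logistic_coeff j" and "10 + l \<le> j + e" for j l e
  proof -
    have "2 ^ m * (2 ^ j * 2 ^ e) dvd
        2 ^ l * (int ((n + b) choose j) - int (b choose j)) * (a ^ j * logistic_coeff j)"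
      using assms that two_power_dvd_binomial_diff by (intro mult_dvd_mono dvd_power_same) auto
    then have "2 ^ (m + (j + e)) dvd 2 ^ l * t j"
      by (simp add: t_def power_add mult_ac)
    moreover have "(2::int) ^ (l + (m + 10)) dvd 2 ^ (m + (j + e))"
      using that by (intro le_imp_power_dvd) auto
    ultimately have "2 ^ (l + (m + 10)) dvd 2 ^ l * t j"
      using dvd_trans by blast
    then show ?thesis
      by (simp only: power_add [of _ l]) simp
  qed
  have "2 ^ (m + 10) dvd t j" if "9 \<le> j" for j
  proof (cases "13 \<le> j")
    case True
    \<comment> \<open>With \<open>e = 0\<close> the largest admissible loss is
      \<open>l = j - 10\<close>. This bound fails at 12, hence the case split at 13.\<close>
    then have "j < 2 ^ Suc (j - 10)"
    proof (induction j rule: dec_induct)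
      case (step j)
      then have "Suc j - 10 = Suc (j - 10)"
        by simp
      with step show ?case
        by simp
    qed simp
    then show ?thesis
      using True by (intro t_dvd [of j "j - 10" 0]) auto
  next
    case False
    with that have "j = 9 \<or> j = 10 \<or> j = 11 \<or> j = 12"
      by arith
    \<comment> \<open>The coefficients at 10 and 12 are zero; those at 9 and 11 are
      \<open>- 31 * 2 ^ 8\<close> and \<open>691 * 2 ^ 9\<close>.\<close>
    then show ?thesis
      using t_dvd [of 9 3 8] t_dvd [of 11 3 8]
      by (auto simp: logistic_coeff_values t_def)
  qed
  then have "[(\<Sum>i=9..<N. t i) = 0] (mod (2 ^ (m + 10)))"
    by (auto simp: cong_0_iff intro!: dvd_sum)
  moreover have "(\<Sum>i<9. t i) = - (a * int n) + 2 * a ^ 3 * (int ((n + b) choose 3) - int (b choose 3))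
      - 16 * a ^ 5 * (int ((n + b) choose 5) - int (b choose 5))
      + 272 * a ^ 7 * (int ((n + b) choose 7) - int (b choose 7))"
    by (simp add: t_def logistic_coeff_values lessThan_nat_numeral)
  ultimately show ?thesis
    unfolding split by (metis add.right_neutral cong_add_lcancel)
qed

section \<open>Polynomial cofactors modulo \<open>2 ^ 10\<close>\<close>

lemma falling_factorial_diff_3:
  fixes n b :: int
  shows "(\<Prod>i<3. n + b - int i) - (\<Prod>i<3. b - int i) =
    n * (3 * b ^ 2 - 6 * b + 2 + 3 * n * (b - 1) + n ^ 2)"
  by (simp add: lessThan_nat_numeral) algebra

text \<open>The remainder \<open>r\<close> may stay unspecified: it will enter as
  \<open>42 * a ^ 5 * n * r\<close>, a multiple of \<open>2 ^ 10\<close> for even \<open>a\<close>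
  and \<open>16 dvd n\<close>. The same holds in degree 7.\<close>

lemma falling_factorial_diff_5:
  fixes n b :: int
  obtains r where "(\<Prod>i<5. n + b - int i) - (\<Prod>i<5. b - int i) =
    n * (5 * b ^ 4 - 40 * b ^ 3 + 105 * b ^ 2 - 100 * b + 24 + n * r)"
proof
  show "(\<Prod>i<5. n + b - int i) - (\<Prod>i<5. b - int i) =
    n * (5 * b ^ 4 - 40 * b ^ 3 + 105 * b ^ 2 - 100 * b + 24 +
      n * (10 * b ^ 3 - 60 * b ^ 2 + 105 * b - 50 +
        n * (10 * b ^ 2 - 40 * b + 35 + n * (5 * b - 10 + n))))"
    by (simp add: lessThan_nat_numeral) algebra
qed

lemma falling_factorial_diff_7:
  fixes n b :: int
  obtains r where "(\<Prod>i<7. n + b - int i) - (\<Prod>i<7. b - int i) =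
    n * (7 * b ^ 6 - 126 * b ^ 5 + 875 * b ^ 4 - 2940 * b ^ 3 + 4872 * b ^ 2 - 3528 * b + 720 + n * r)"
proof
  show "(\<Prod>i<7. n + b - int i) - (\<Prod>i<7. b - int i) =
    n * (7 * b ^ 6 - 126 * b ^ 5 + 875 * b ^ 4 - 2940 * b ^ 3 + 4872 * b ^ 2 - 3528 * b + 720 +
      n * (21 * b ^ 5 - 315 * b ^ 4 + 1750 * b ^ 3 - 4410 * b ^ 2 + 4872 * b - 1764 +
        n * (35 * b ^ 4 - 420 * b ^ 3 + 1750 * b ^ 2 - 2940 * b + 1624 +
          n * (35 * b ^ 3 - 315 * b ^ 2 + 875 * b - 735 +
            n * (21 * b ^ 2 - 126 * b + 175 + n * (7 * b - 21 + n))))))"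
    by (simp add: lessThan_nat_numeral) algebra
qed

text \<open>In \<open>c ^ 3 * (c ^ 2 - 1)\<close> the first factor is divisible by 4 for even
  \<open>c\<close>, the second for odd \<open>c\<close>. This absorbs the terms with coefficient 256
  in \<open>cofactor_dvd\<close>.\<close>

lemma four_dvd_power_diff: "4 dvd c ^ 5 - (c::int) ^ 3"
proof (cases "even c")
  case True
  then obtain f where "c = 2 * f" ..
  then have "c ^ 5 - c ^ 3 = 4 * (8 * f ^ 5 - 2 * f ^ 3)"
    by algebra
  then show ?thesis ..
next
  case False
  then obtain f where "c = 2 * f + 1" ..
  then have "c ^ 5 - c ^ 3 = 4 * (c ^ 3 * (f ^ 2 + f))"
    by algebra
  then show ?thesis ..
qed

text \<open>The terms in \<open>n * (b - 1)\<close> cancel exactly. After halving \<open>a\<close>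
  and splitting \<open>b\<close> by parity, all coefficients are multiples of 256, and those not
  divisible by 1024 are grouped into 512 times an even number and 256 times a multiple of 4.\<close>

lemma cofactor_dvd:
  fixes a b n r s :: int
  assumes "even a" and "16 dvd n"
    and "R = (if even b
      then 9 * a ^ 3 * b ^ 2 - (2 * a ^ 3 - 128 * a) * b + 86 * a ^ 3 - 257 * a + n * a ^ 3 * (b - 1)
      else (a ^ 3 - 2 * a ^ 5) * b ^ 2 + (30 * a ^ 3 + 128 * a) * b - 2 * a ^ 5 + 86 * a ^ 3 + 127 * a
        + n * a ^ 3 * (b - 1))"
  shows "2 ^ 10 dvd - 315 * a + 105 * a ^ 3 * (3 * b ^ 2 - 6 * b + 2 + 3 * n * (b - 1) + n ^ 2)
    - 42 * a ^ 5 * (5 * b ^ 4 - 40 * b ^ 3 + 105 * b ^ 2 - 100 * b + 24 + n * r)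
    + 17 * a ^ 7 * (7 * b ^ 6 - 126 * b ^ 5 + 875 * b ^ 4 - 2940 * b ^ 3 + 4872 * b ^ 2
        - 3528 * b + 720 + n * s)
    - 315 * R" (is "_ dvd ?X")
proof -
  obtain c where c: "a = 2 * c"
    using \<open>even a\<close> ..
  obtain e where e: "n = 16 * e"
    using \<open>16 dvd n\<close> ..
  obtain q where q: "c ^ 5 - c ^ 3 = 4 * q"
    using four_dvd_power_diff ..
  \<comment> \<open>The contributions of \<open>n ^ 2\<close>, \<open>n * r\<close> and
    \<open>n * s\<close>, divided by 1024.\<close>
  define T where "T = 210 * c ^ 3 * e ^ 2 - 21 * c ^ 5 * e * r + 34 * c ^ 7 * e * s"
  show ?thesis
  proof (cases "even b")
    case True
    then obtain d where d: "b = 2 * d" ..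
    have "even ((c + c ^ 5) * (1 + d))"
      by simp
    then obtain h where h: "(c + c ^ 5) * (1 + d) = 2 * h" ..
    have "?X = 1024 * (T + c * (157 - 158 * d) - c ^ 3 * (210 + 79 * d ^ 2)
        - c ^ 5 * (32 - 262 * d + 551 * d ^ 2 - 420 * d ^ 3 + 105 * d ^ 4)
        + c ^ 7 * (1530 - 14994 * d + 41412 * d ^ 2 - 49980 * d ^ 3 + 29750 * d ^ 4 - 8568 * d ^ 5 + 952 * d ^ 6))
        + 512 * ((c + c ^ 5) * (1 + d)) - 256 * d ^ 2 * (c ^ 5 - c ^ 3)"
      unfolding T_def c d e assms(3) by simp algebra
    then show ?thesis
      unfolding h q by simp
  next
    case False
    then obtain d where d: "b = 2 * d + 1" ..
    \<comment> \<open>Modulo 2, powers of \<open>c\<close> reduce to \<open>c\<close> and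
      \<open>d ^ 2\<close> to \<open>d\<close>, leaving \<open>2 * c + 4 * c * d\<close>.\<close>
    have "even (c * (1 + d) + (c ^ 3 + c ^ 5) * d + c ^ 7 * d ^ 2 + c ^ 3)"
      by auto
    then obtain h where h: "c * (1 + d) + (c ^ 3 + c ^ 5) * d + c ^ 7 * d ^ 2 + c ^ 3 = 2 * h" ..
    have "?X = 1024 * (T - c * (158 + 158 * d) - c ^ 3 * (289 + 158 * d)
        + c ^ 5 * (47 + 52 * d + 210 * d ^ 3 - 105 * d ^ 4)
        - c ^ 7 * (255 - 1309 * d - 1249 * d ^ 2 + 9520 * d ^ 3 - 11900 * d ^ 4 + 5712 * d ^ 5 - 952 * d ^ 6))
        + 512 * (c * (1 + d) + (c ^ 3 + c ^ 5) * d + c ^ 7 * d ^ 2 + c ^ 3) + 256 * (c ^ 5 - c ^ 3)"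
      unfolding T_def c d e assms(3) by simp algebra
    then show ?thesis
      unfolding h q by simp
  qed
qed

text \<open>The factor \<open>n\<close> supplies \<open>2 ^ m\<close>, so
  \<open>cofactor_dvd\<close> only has to supply \<open>2 ^ 10\<close>. Defining \<open>R\<close> by
  cases lets one argument serve both parities of \<open>b\<close>.\<close>

lemma gen_euler_diff_cong_parity:
  fixes a :: int and n m b :: nat
  assumes "even a" and "2 ^ m dvd n" and "m \<ge> 4"
    and R: "R = (if even b
      then 9 * a ^ 3 * int b ^ 2 - (2 * a ^ 3 - 128 * a) * int b + 86 * a ^ 3 - 257 * a
        + int n * a ^ 3 * (int b - 1)
      else (a ^ 3 - 2 * a ^ 5) * int b ^ 2 + (30 * a ^ 3 + 128 * a) * int b - 2 * a ^ 5 + 86 * a ^ 3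
        + 127 * a + int n * a ^ 3 * (int b - 1))"
  shows "[gen_euler a (n + b) - gen_euler a b = int n * R] (mod (2 ^ (m + 10)))"
proof -
  define C where "C j = int ((n + b) choose j) - int (b choose j)" for j
  let ?D = "- (a * int n) + 2 * a ^ 3 * C 3 - 16 * a ^ 5 * C 5 + 272 * a ^ 7 * C 7"
  have C: "fact j * C j = (\<Prod>i<j. int n + int b - int i) - (\<Prod>i<j. int b - int i)" for j
    by (simp add: C_def right_diff_distrib fact_mult_binomial)
  have C3: "6 * C 3 = int n * (3 * int b ^ 2 - 6 * int b + 2 + 3 * int n * (int b - 1) + int n ^ 2)"
    using C [of 3] falling_factorial_diff_3 [of "int n" "int b"] by (simp add: fact_numeral)
  obtain r where C5: "120 * C 5 =
      int n * (5 * int b ^ 4 - 40 * int b ^ 3 + 105 * int b ^ 2 - 100 * int b + 24 + int n * r)"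
    using C [of 5] falling_factorial_diff_5 [of "int n" "int b"] by (auto simp: fact_numeral)
  obtain s where C7: "5040 * C 7 =
      int n * (7 * int b ^ 6 - 126 * int b ^ 5 + 875 * int b ^ 4 - 2940 * int b ^ 3
        + 4872 * int b ^ 2 - 3528 * int b + 720 + int n * s)"
    using C [of 7] falling_factorial_diff_7 [of "int n" "int b"] by (auto simp: fact_numeral)
  have "(16::nat) dvd n"
    using assms le_imp_power_dvd [of 4 m "2::nat"] dvd_trans by fastforce
  then have 16: "16 dvd int n"
    by presburger
  \<comment> \<open>\<open>315\<close> is the odd part of \<open>5040 = 7!\<close>, hence it clears the denominators of all three
    binomial coefficients and is invertible modulo powers of \<open>2\<close>.\<close>
  have "315 * (?D - int n * R) =
      - 315 * a * int n + 105 * a ^ 3 * (6 * C 3) - 42 * a ^ 5 * (120 * C 5) + 17 * a ^ 7 * (5040 * C 7)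
      - 315 * R * int n"
    by algebra
  also have "\<dots> = int n *
      (- 315 * a + 105 * a ^ 3 * (3 * int b ^ 2 - 6 * int b + 2 + 3 * int n * (int b - 1) + int n ^ 2)
      - 42 * a ^ 5 * (5 * int b ^ 4 - 40 * int b ^ 3 + 105 * int b ^ 2 - 100 * int b + 24 + int n * r)
      + 17 * a ^ 7 * (7 * int b ^ 6 - 126 * int b ^ 5 + 875 * int b ^ 4 - 2940 * int b ^ 3
          + 4872 * int b ^ 2 - 3528 * int b + 720 + int n * s)
      - 315 * R)"
    unfolding C3 C5 C7 by algebra
  also have "2 ^ m * 2 ^ 10 dvd \<dots>"
  proof (rule mult_dvd_mono)
    show "2 ^ m dvd int n"
      using assms(2) of_nat_dvd_iff [of "2 ^ m" n, where 'a = int] by simp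
  qed (rule cofactor_dvd, use assms 16 in auto)
  finally have "2 ^ (m + 10) dvd 315 * (?D - int n * R)"
    by (simp only: power_add)
  moreover have "coprime (2 ^ (m + 10)) (315 :: int)"
    by simp
  ultimately have "[?D = int n * R] (mod (2 ^ (m + 10)))"
    unfolding cong_iff_dvd_diff using coprime_dvd_mult_right_iff by blast
  then show ?thesis
    using gen_euler_diff_cong_binomial [OF assms(1,2), of b] cong_trans by (fastforce simp: C_def)
qed

theorem theorem2p1:
  fixes a :: int and k m b :: nat
  assumes "a \<noteq> 0" and "even a" and "k > 0" and "m \<ge> 4"
  shows "(even b \<longrightarrow>
           [gen_euler a (2 ^ m * k + b) - gen_euler a b =
            2 ^ m * int k * (9 * a ^ 3 * (int b) ^ 2 - (2 * a ^ 3 - 128 * a) * int b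
              + 86 * a ^ 3 - 257 * a + 2 ^ m * int k * a ^ 3 * (int b - 1))]
           (mod (2 ^ (m + 10)))) \<and>
         (odd b \<longrightarrow>
           [gen_euler a (2 ^ m * k + b) - gen_euler a b =
            2 ^ m * int k * ((a ^ 3 - 2 * a ^ 5) * (int b) ^ 2 + (30 * a ^ 3 + 128 * a) * int b
              - 2 * a ^ 5 + 86 * a ^ 3 + 127 * a + 2 ^ m * int k * a ^ 3 * (int b - 1))]
           (mod (2 ^ (m + 10))))"
  using gen_euler_diff_cong_parity [OF \<open>even a\<close> dvd_triv_left \<open>m \<ge> 4\<close> refl, of k b] by auto

end
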